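(* For $\operatorname{Re}(z)>0$, we have $$J(-z)=J(z)+\frac{z\pi^2}{12}.$$
   Context: For $\operatorname{Re}(z)>0$, the function $J$ is defined by $$J(z)=\int_0^1\frac{\log(1+t^z)}{1+t}\,dt.$$ The value $J(-z)$ in the left half plane is the same integral with $z$ replaced by $-z$, that is, $J(-z)=\int_0^1\frac{\log(1+t^{-z})}{1+t}\,dt$.
   Formalization: In J(-z) the logarithm log(1+t^{-z}) is taken as the branch continuous in t on (0,1] with value log 2 at t=1; with the principal logarithm the identity fails for non-real z (e.g. z=1+10i). For J(z) with Re(z)>0, and for real z, this is the principal logarithm. *)

theory Defs
  imports "HOL-Analysis.Analysis"
begin

text \<open>
  For \<open>Re w > 0\<close> the point \<open>1 + t powr w\<close> stays in the right half plane as \<open>t\<close> runs through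
  \<open>{0<..1}\<close>, so the logarithm in the integrand is the principal one.  For \<open>Re w < 0\<close> and
  \<open>Im w \<noteq> 0\<close> the point \<open>1 + t powr w\<close> winds infinitely often around 0 as \<open>t\<close> tends to 0: the
  principal logarithm would jump at infinitely many \<open>t\<close>.  The logarithm is therefore read, for
  all \<open>w\<close>, as the branch that is continuous in \<open>t\<close> and takes the real value \<open>ln 2\<close> at \<open>t = 1\<close>.
  For \<open>Re w \<noteq> 0\<close> there is exactly one such branch on \<open>{0<..1}\<close>.
\<close>

definition log_branch :: "complex \<Rightarrow> (real \<Rightarrow> complex) \<Rightarrow> bool" where
  "log_branch w L \<longleftrightarrow>
     continuous_on {0<..1} L \<and>
     (\<forall>t\<in>{0<..1}. exp (L t) = 1 + complex_of_real t powr w) \<and>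
     L 1 = complex_of_real (ln 2)"

definition log1p_powr :: "complex \<Rightarrow> real \<Rightarrow> complex" where
  "log1p_powr w = (SOME L. log_branch w L)"

definition J :: "complex \<Rightarrow> complex" where
  "J w = integral {0..1} (\<lambda>t::real. log1p_powr w t / (1 + complex_of_real t))"

lemma continuous_on_one_plus_powr:
  "continuous_on {0<..1} (\<lambda>t. 1 + complex_of_real t powr w)"
  by (intro continuous_intros) auto

lemma one_plus_powr_nonzero:
  assumes "Re w \<noteq> 0" "t \<in> {0<..1}"
  shows "1 + complex_of_real t powr w \<noteq> 0"
proof
  assume "1 + complex_of_real t powr w = 0"
  hence e: "complex_of_real t powr w = -1"
    by (simp add: add_eq_0_iff)
  hence "norm (complex_of_real t powr w) = 1"
    by simp
  hence "t powr Re w = 1"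
    using assms by (simp add: norm_powr_real_powr)
  hence "t = 1"
    using assms by (auto simp: powr_def)
  with e show False
    by simp
qed

lemma log_branch_exists:
  assumes "Re w \<noteq> 0"
  shows "\<exists>L. log_branch w L"
proof -
  have "contractible {0<..1::real}"
    by (simp add: convex_imp_contractible)
  then obtain g where g: "continuous_on {0<..1} g"
    "\<And>t. t \<in> {0<..1} \<Longrightarrow> 1 + complex_of_real t powr w = exp (g t)"
    using continuous_logarithm_on_contractible [OF continuous_on_one_plus_powr]
      one_plus_powr_nonzero [OF assms] by metis
  have "exp (complex_of_real (ln 2)) = 2"
    by (metis exp_ln exp_of_real of_real_numeral zero_less_numeral)
  moreover have "exp (g 1) = 2"
    using g(2)[of 1] by simp
  ultimately have "log_branch w (\<lambda>t. g t + (complex_of_real (ln 2) - g 1))"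
    using g by (auto simp: log_branch_def exp_add exp_diff intro!: continuous_intros)
  thus ?thesis by blast
qed

lemma log_branch_unique:
  assumes "Re w \<noteq> 0" "log_branch w L" "log_branch w M" "t \<in> {0<..1}"
  shows "L t = M t"
proof (rule covering_space_lift_unique
    [OF covering_space_exp_punctured_plane, where a = 1 and T = "{0<..1::real}"
        and f = "\<lambda>t. 1 + complex_of_real t powr w"])
  show "(\<lambda>t. 1 + complex_of_real t powr w) \<in> {0<..1} \<rightarrow> - {0}"
    using one_plus_powr_nonzero[OF assms(1)] by auto
  show "connected {0<..1::real}"
    by (simp add: convex_connected)
qed (use assms continuous_on_one_plus_powr in \<open>auto simp: log_branch_def\<close>)

lemma log_branch_log1p_powr:
  "Re w \<noteq> 0 \<Longrightarrow> log_branch w (log1p_powr w)"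
  unfolding log1p_powr_def by (rule someI_ex [OF log_branch_exists])

lemma log1p_powr_eq_Ln:
  assumes "Re z > 0" "t \<in> {0<..1}"
  shows "log1p_powr z t = Ln (1 + complex_of_real t powr z)"
proof (rule log_branch_unique [OF _ log_branch_log1p_powr])
  have "0 < Re (1 + complex_of_real t powr z)" if t: "t \<in> {0<..1}" for t
  proof (cases "t = 1")
    case False
    have "norm (complex_of_real t powr z) = t powr Re z"
      using t by (simp add: norm_powr_real_powr)
    also have "\<dots> < 1"
      using t False assms(1) by (auto simp: powr_def mult_pos_neg)
    finally have "norm (complex_of_real t powr z) < 1" .
    thus ?thesis
      using abs_Re_le_cmod[of "complex_of_real t powr z"] by (simp add: abs_if split: if_splits)
  qed auto
  hence "1 + complex_of_real t powr z \<notin> \<real>\<^sub>\<le>\<^sub>0" if "t \<in> {0<..1}" for t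
    using that by (meson complex_nonpos_Reals_iff not_le)
  moreover have "Ln 2 = complex_of_real (ln 2)"
    using Ln_of_real[of 2] by simp
  ultimately show "log_branch z (\<lambda>t. Ln (1 + complex_of_real t powr z))"
    using one_plus_powr_nonzero[of z] assms(1)
    by (auto simp: log_branch_def intro!: continuous_on_Ln' continuous_on_one_plus_powr)
qed (use assms in auto)

lemma J_eq_Ln:
  assumes "Re z > 0"
  shows "J z = integral {0..1}
           (\<lambda>t::real. Ln (1 + complex_of_real t powr z) / (1 + complex_of_real t))"
  unfolding J_def
  by (rule integral_spike [of "{0}"]) (auto simp: log1p_powr_eq_Ln [OF assms])

end

theory Submission
  imports Defs "HOL-Real_Asymp.Real_Asymp"
begin

text \<open>
  The factorisation \<open>1 + t\<^sup>-\<^sup>z = t\<^sup>-\<^sup>z (1 + t\<^sup>z)\<close> shows that \<open>log (1 + t\<^sup>z) - z ln t\<close> is a continuous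
  logarithm of \<open>1 + t\<^sup>-\<^sup>z\<close> on \<open>{0<..1}\<close> with the value \<open>ln 2\<close> at \<open>t = 1\<close>.  Uniqueness of the branch
  identifies it with the logarithm in the integrand of \<open>J (- z)\<close> (\<open>log1p_powr_minus\<close>), so that
  \<open>J (- z) = J z - z \<integral>\<^sub>0\<^sup>1 ln t / (1 + t) dt\<close>.

  The remaining integral is \<open>- pi\<^sup>2 / 12\<close>.  By parts, \<open>ln t / (1 + t)\<close> has the
  antiderivative \<open>ln t ln (1 + t) - G t\<close>, where \<open>G' t = ln (1 + t) / t\<close>, that is,
  \<open>G t = (\<Sum>n. (- 1)\<^sup>n\<^sup>+\<^sup>1 t\<^sup>n / n\<^sup>2)\<close>, a dilogarithm.  The product vanishes at both
  endpoints, and \<open>G 1 = 1 - 1/4 + 1/9 - \<dots> = pi\<^sup>2 / 12\<close> follows from Euler's series for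
  \<open>pi\<^sup>2 / 6\<close>.  Splitting the integral is legitimate because both parts are integrable: the first
  integrand extends continuously to \<open>t = 0\<close>, and the second has just been integrated.
\<close>

text \<open>
  Changing the signs at the even squares subtracts twice the sum of \<open>1 / (2 k)\<^sup>2\<close>, which is half
  of the full sum.
\<close>

lemma alternating_inverse_squares_sums:
  "(\<lambda>n. (-1) ^ n / real (Suc n) ^ 2) sums (pi\<^sup>2 / 12)"
proof -
  have euler: "(\<lambda>n. 1 / real (Suc n) ^ 2) sums (pi\<^sup>2 / 6)"
    using inverse_squares_sums by (simp add: add.commute)
  have "(\<lambda>n. (1 / 2) * (1 / real (Suc n) ^ 2)) sums ((1 / 2) * (pi\<^sup>2 / 6))"
    by (rule sums_mult [OF euler])
  hence "(\<lambda>n. if even n then 0 else (1 / 2) * (1 / real (Suc ((n - 1) div 2)) ^ 2))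
           sums ((1 / 2) * (pi\<^sup>2 / 6))"
    by (rule sums_if')
  from sums_diff [OF euler this]
  have "(\<lambda>n. 1 / real (Suc n) ^ 2 -
           (if even n then 0 else (1 / 2) * (1 / real (Suc ((n - 1) div 2)) ^ 2)))
          sums (pi\<^sup>2 / 12)"
    by simp
  moreover have "1 / real (Suc n) ^ 2 -
      (if even n then 0 else (1 / 2) * (1 / real (Suc ((n - 1) div 2)) ^ 2))
      = (-1) ^ n / real (Suc n) ^ 2" for n
  proof (cases "even n")
    case False
    then obtain k where k: "n = 2 * k + 1" by (elim oddE)
    have "real (Suc n) = 2 * real (Suc k)" by (simp add: k)
    hence "real (Suc n) ^ 2 = 4 * real (Suc k) ^ 2"
      by (simp only: power_mult_distrib) simp
    with False k show ?thesis by (simp add: field_simps)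
  qed auto
  ultimately show ?thesis by simp
qed

text \<open>
  In terms of the dilogarithm, \<open>alternating_dilog t\<close> is \<open>- Li\<^sub>2 (- t)\<close>.  The term at
  \<open>n = 0\<close> is a division by zero and so vanishes.
\<close>

definition alternating_dilog :: "real \<Rightarrow> real" where
  "alternating_dilog t = (\<Sum>n. (-1) ^ Suc n / real n ^ 2 * t ^ n)"

lemma alternating_dilog_0 [simp]: "alternating_dilog 0 = 0"
proof -
  have "(-1) ^ Suc n / real n ^ 2 * 0 ^ n = (0 :: real)" for n
    by (cases n) auto
  thus ?thesis by (simp only: alternating_dilog_def suminf_zero)
qed

lemma alternating_dilog_1: "alternating_dilog 1 = pi\<^sup>2 / 12"
proof -
  have "(\<lambda>n. (-1) ^ Suc (Suc n) / real (Suc n) ^ 2) sums (pi\<^sup>2 / 12)"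
    using alternating_inverse_squares_sums by simp
  hence "(\<lambda>n. (-1) ^ Suc n / real n ^ 2) sums (pi\<^sup>2 / 12)"
    by (subst (asm) sums_Suc_iff) simp
  thus ?thesis by (simp add: alternating_dilog_def sums_iff)
qed

lemma continuous_on_alternating_dilog: "continuous_on {0..1} alternating_dilog"
proof -
  have "uniform_limit {0..1} (\<lambda>n t::real. \<Sum>i<n. (-1) ^ Suc i / real i ^ 2 * t ^ i)
          (\<lambda>t. \<Sum>i. (-1) ^ Suc i / real i ^ 2 * t ^ i) sequentially"
  proof (rule Weierstrass_m_test)
    show "norm ((-1) ^ Suc n / real n ^ 2 * t ^ n) \<le> 1 / real n ^ 2"
      if "t \<in> {0..1}" for n and t :: real
      using that by (simp add: abs_mult power_abs mult_left_le power_le_one divide_right_mono)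
    show "summable (\<lambda>n. 1 / real n ^ 2)"
      using inverse_power_summable [of 2, where 'a = real] by (simp add: field_simps)
  qed
  hence "continuous_on {0..1} (\<lambda>t. \<Sum>i. (-1) ^ Suc i / real i ^ 2 * t ^ i :: real)"
    by (rule uniform_limit_theorem [rotated])
       (intro always_eventually allI continuous_on_sum continuous_on_mult continuous_on_const
         continuous_on_power continuous_on_id sequentially_bot)+
  thus ?thesis by (simp add: alternating_dilog_def [abs_def])
qed

text \<open>Termwise differentiation yields the Mercator series of \<open>ln (1 + t)\<close>, divided by \<open>t\<close>.\<close>

lemma DERIV_alternating_dilog:
  assumes "0 < t" "t < 1"
  shows "(alternating_dilog has_real_derivative ln (1 + t) / t) (at t)"
proof -
  let ?c = "\<lambda>n. (-1) ^ Suc n / real n ^ 2"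
  have "summable (\<lambda>n. (-1) ^ Suc (Suc n) / real (Suc n) ^ 2)"
    using alternating_inverse_squares_sums by (auto simp: sums_iff)
  hence "summable (\<lambda>n. ?c n * 1 ^ n)"
    by (subst (asm) summable_Suc_iff) simp
  from termdiffs_strong [OF this, of t] assms
  have "(alternating_dilog has_real_derivative (\<Sum>n. diffs ?c n * t ^ n)) (at t)"
    by (simp add: alternating_dilog_def [abs_def])
  moreover have "(\<lambda>n. diffs ?c n * t ^ n) sums (ln (1 + t) / t)"
  proof -
    have "(\<lambda>n. - ((- t) ^ n) / of_nat n) sums ln (1 + t)"
      using assms by (intro ln_series') simp
    hence "(\<lambda>n. - ((- t) ^ Suc n) / of_nat (Suc n)) sums ln (1 + t)"
      by (subst sums_Suc_iff) simp
    hence "(\<lambda>n. - ((- t) ^ Suc n) / of_nat (Suc n) / t) sums (ln (1 + t) / t)"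
      by (rule sums_divide)
    moreover have "- ((- t) ^ Suc n) / of_nat (Suc n) / t = diffs ?c n * t ^ n" for n
      using assms by (simp add: diffs_def power2_eq_square power_minus [of t])
    ultimately show ?thesis by simp
  qed
  ultimately show ?thesis by (simp add: sums_iff)
qed

text \<open>
  Differentiating \<open>ln t ln (1 + t)\<close> leaves the unwanted term \<open>ln (1 + t) / t\<close>, which the
  dilogarithm cancels.  The product tends to \<open>0\<close> as \<open>t\<close> tends to \<open>0\<close>, which is also its value
  there under the convention \<open>ln 0 = 0\<close>, so the fundamental theorem applies up to the endpoint.
\<close>

lemma has_integral_ln_over_one_plus:
  "((\<lambda>t. ln t / (1 + t)) has_integral - (pi\<^sup>2 / 12)) {0..1::real}"
proof -
  let ?F = "\<lambda>t::real. ln t * ln (1 + t) - alternating_dilog t"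
  have "continuous_on {0..1} (\<lambda>t::real. ln t * ln (1 + t))"
  proof (clarsimp simp: continuous_on_eq_continuous_within)
    fix x :: real assume x: "0 \<le> x" "x \<le> 1"
    show "continuous (at x within {0..1}) (\<lambda>t. ln t * ln (1 + t))"
    proof (cases "x = 0")
      case True
      have "((\<lambda>t::real. ln t * ln (1 + t)) \<longlongrightarrow> 0) (at_right 0)"
        by real_asymp
      hence "((\<lambda>t::real. ln t * ln (1 + t)) \<longlongrightarrow> 0) (at 0 within {0..1})"
        by (simp add: at_within_Icc_at_right)
      with True show ?thesis by (simp add: continuous_within)
    next
      case False
      with x show ?thesis by (intro continuous_intros) auto
    qed
  qed
  hence "continuous_on {0..1} ?F"
    by (intro continuous_on_diff continuous_on_alternating_dilog)
  moreover have "(?F has_vector_derivative ln t / (1 + t)) (at t)" if "t \<in> {0<..<1}" for t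
  proof -
    have "(?F has_real_derivative
             (ln t * (1 / (1 + t)) + (1 / t) * ln (1 + t)) - ln (1 + t) / t) (at t)"
      using that
      by (intro DERIV_diff DERIV_alternating_dilog)
         (auto intro!: derivative_eq_intros simp: divide_inverse)
    thus ?thesis by (simp add: has_real_derivative_iff_has_vector_derivative)
  qed
  ultimately have "((\<lambda>t. ln t / (1 + t)) has_integral (?F 1 - ?F 0)) {0..1}"
    by (intro fundamental_theorem_of_calculus_interior) auto
  thus ?thesis by (simp add: alternating_dilog_1)
qed

text \<open>
  Both sides are continuous logarithms of \<open>1 + t\<^sup>-\<^sup>z = t\<^sup>-\<^sup>z (1 + t\<^sup>z)\<close> that agree at \<open>t = 1\<close>.
\<close>

lemma log1p_powr_minus:
  assumes "Re z > 0" "t \<in> {0<..1}"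
  shows "log1p_powr (- z) t = log1p_powr z t - z * complex_of_real (ln t)"
proof (rule log_branch_unique [OF _ log_branch_log1p_powr])
  let ?L = "\<lambda>t. log1p_powr z t - z * complex_of_real (ln t)"
  have L: "log_branch z (log1p_powr z)"
    using assms by (intro log_branch_log1p_powr) auto
  show "log_branch (- z) ?L"
    unfolding log_branch_def
  proof (intro conjI ballI)
    show "continuous_on {0<..1} ?L"
      using L by (intro continuous_intros) (auto simp: log_branch_def)
    show "exp (?L t) = 1 + complex_of_real t powr (- z)" if "t \<in> {0<..1}" for t
    proof -
      have "exp (?L t) = (1 + complex_of_real t powr z) * complex_of_real t powr (- z)"
        using L that
        by (simp add: log_branch_def exp_diff powr_def Ln_of_real exp_minus divide_inverse)
      also have "\<dots> = 1 + complex_of_real t powr (- z)"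
        using that by (simp add: distrib_right flip: powr_add)
      finally show ?thesis .
    qed
    show "?L 1 = complex_of_real (ln 2)"
      using L by (simp add: log_branch_def)
  qed
qed (use assms in auto)

text \<open>
  The integrand extends continuously to \<open>t = 0\<close>: there \<open>0 powr z = 0\<close> agrees with the limit of
  \<open>t\<^sup>z\<close>, because \<open>Re z > 0\<close>.
\<close>

lemma integrable_log1p_powr:
  assumes "Re z > 0"
  shows "(\<lambda>t. log1p_powr z t / (1 + complex_of_real t)) integrable_on {0..1}"
proof -
  let ?f = "\<lambda>t. Ln (1 + complex_of_real t powr z) / (1 + complex_of_real t)"
  \<comment> \<open>Since \<open>\<bar>t\<^sup>z\<bar> \<le> 1\<close>, the point \<open>1 + t\<^sup>z\<close> could meet the branch cut only at its end \<open>0\<close>.\<close>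
  have "1 + complex_of_real t powr z \<notin> \<real>\<^sub>\<le>\<^sub>0" if t: "t \<in> {0..1}" for t
  proof (cases "t = 0")
    case False
    with t have "norm (complex_of_real t powr z) \<le> 1"
      using assms by (simp add: norm_powr_real_powr powr_le1)
    hence "0 \<le> Re (1 + complex_of_real t powr z)"
      using abs_Re_le_cmod [of "complex_of_real t powr z"] by simp
    moreover have "1 + complex_of_real t powr z \<noteq> 0"
      using one_plus_powr_nonzero [of z t] assms t False by simp
    ultimately show ?thesis
      by (metis complex_nonpos_Reals_iff antisym complex_eq_iff zero_complex.sel)
  qed simp
  moreover have "1 + complex_of_real t \<noteq> 0" if "t \<in> {0..1}" for t
    using that by (simp add: complex_eq_iff)
  ultimately have "continuous_on {0..1} ?f"
    using assms by (intro continuous_intros) auto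
  hence "?f integrable_on {0..1}"
    by (rule integrable_continuous_real)
  thus ?thesis
    by (rule integrable_spike [where S = "{0}"]) (auto simp: log1p_powr_eq_Ln [OF assms])
qed

theorem theorem2p2:
  fixes z :: complex
  assumes "Re z > 0"
  shows "J (- z) = J z + z * complex_of_real (pi\<^sup>2) / 12"
proof -
  have "((\<lambda>t. z * complex_of_real (ln t / (1 + t))) has_integral
           z * complex_of_real (- (pi\<^sup>2 / 12))) {0..1}"
    by (intro has_integral_mult_right
          has_integral_linear [OF has_integral_ln_over_one_plus bounded_linear_of_real,
            unfolded o_def])
  moreover have "((\<lambda>t. log1p_powr z t / (1 + complex_of_real t)) has_integral J z) {0..1}"
    using integrable_log1p_powr [OF assms] by (simp add: J_def has_integral_integral)
  ultimately have
    "((\<lambda>t. log1p_powr z t / (1 + complex_of_real t) - z * complex_of_real (ln t / (1 + t)))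
       has_integral J z - z * complex_of_real (- (pi\<^sup>2 / 12))) {0..1}"
    by (intro has_integral_diff)
  \<comment> \<open>The branches are only controlled on \<open>{0<..1}\<close>, so the point \<open>0\<close> is discarded.\<close>
  hence "((\<lambda>t. log1p_powr (- z) t / (1 + complex_of_real t))
       has_integral J z - z * complex_of_real (- (pi\<^sup>2 / 12))) {0..1}"
    by (rule has_integral_spike [where S = "{0}", rotated 2])
       (auto simp: log1p_powr_minus [OF assms] diff_divide_distrib)
  thus ?thesis
    by (simp add: J_def integral_unique)
qed

end
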